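(* Let $n\ge 1$ and $0\le k\le n/2$ be integers, and put $p=k/n$. Endow the slice $\binom{[n]}{k}$ with the uniform measure. The set $\{\chi_B : B\in\mathcal{B}_{n,d}\text{ for some } d\le k\}$ (each polynomial $\chi_B$ being restricted to a function on $\binom{[n]}{k}$) is an orthogonal basis for the vector space of functions $\binom{[n]}{k}\to\mathbb{R}$, and for every $d\le k$ and $B=b_1,\dots,b_d\in\mathcal{B}_{n,d}$, $$\|\chi_B\|^2=c_B\,2^d\,\frac{k^{\underline{d}}\,(n-k)^{\underline{d}}}{n^{\underline{2d}}}=c_B\,(2p(1-p))^d\left(1\pm O_p\!\left(\frac{d^2}{n}\right)\right),$$ where $c_B=\prod_{i=1}^d\frac{(b_i-2(i-1))(b_i-2(i-1)-1)}{2}$.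
   Context: The slice is $\binom{[n]}{k}=\{(x_1,\dots,x_n)\in\{0,1\}^n:\sum_i x_i=k\}$. For functions $f,g$ on the slice, $\langle f,g\rangle=\mathbb{E}[fg]$ and $\|f\|^2=\mathbb{E}[f^2]$, with expectation over the uniform distribution on the slice. Write $[n]=\{1,\dots,n\}$. For an integer $0\le d\le n/2$, $\mathcal{S}_{n,d}$ is the set of sequences $S=s_1,\dots,s_d$ of distinct elements of $[n]$. For disjoint $A,B\in\mathcal{S}_{n,d}$ (no common elements), let $\chi_{A,B}=\prod_{i=1}^d (x_{a_i}-x_{b_i})$, and write $A<B$ if $a_i<b_i$ for all $i\in[d]$ ($A$ need not be increasing). A top set of length $d$ is an increasing sequence $B\in\mathcal{S}_{n,d}$ for which there exists a sequence $A\in\mathcal{S}_{n,d}$ disjoint from $B$ with $A<B$. $\mathcal{B}_{n,d}$ is the set of top sets of length $d$. For $B\in\mathcal{B}_{n,d}$, define $$\chi_B=\sum_{A\in\mathcal{S}_{n,d}:\ A\cap B=\emptyset,\ A<B}\chi_{A,B}$$ (so $\chi_\emptyset=1$). Falling powers: $n^{\underline{k}}=n(n-1)\cdots(n-k+1)$ ($k$ factors). The notation $X=Y(1\pm O_p(d^2/n))$ means that there is a constant $C_p$ depending only on $p$ such that $(1-C_p d^2/n)Y\le X\le(1+C_p d^2/n)Y$. *)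

theory Defs
  imports "HOL-Probability.Probability" "HOL-Library.Function_Algebras"
begin

definition slice :: "nat \<Rightarrow> nat \<Rightarrow> (nat \<Rightarrow> real) set" where
  "slice n k = {x \<in> {1..n} \<rightarrow>\<^sub>E {0, 1}. (\<Sum>i = 1..n. x i) = real k}"

definition slice_inner ::
    "nat \<Rightarrow> nat \<Rightarrow> ((nat \<Rightarrow> real) \<Rightarrow> real) \<Rightarrow> ((nat \<Rightarrow> real) \<Rightarrow> real) \<Rightarrow> real" where
  "slice_inner n k f g = measure_pmf.expectation (pmf_of_set (slice n k)) (\<lambda>x. f x * g x)"

definition slice_norm :: "nat \<Rightarrow> nat \<Rightarrow> ((nat \<Rightarrow> real) \<Rightarrow> real) \<Rightarrow> real" where
  "slice_norm n k f = sqrt (slice_inner n k f f)"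

text \<open>Real-valued functions on the slice are represented by their extensions by zero;
  these form a linear subspace of all functions under pointwise operations.\<close>

definition slice_functions :: "nat \<Rightarrow> nat \<Rightarrow> ((nat \<Rightarrow> real) \<Rightarrow> real) set" where
  "slice_functions n k = {f. \<forall>x. x \<notin> slice n k \<longrightarrow> f x = 0}"

definition slice_restrict ::
    "nat \<Rightarrow> nat \<Rightarrow> ((nat \<Rightarrow> real) \<Rightarrow> real) \<Rightarrow> (nat \<Rightarrow> real) \<Rightarrow> real" where
  "slice_restrict n k f = (\<lambda>x. if x \<in> slice n k then f x else 0)"

global_interpretation real_fun: vector_space "\<lambda>(c::real) (f::'a \<Rightarrow> real) x. c * f x"
  by unfold_locales (auto simp: fun_eq_iff algebra_simps)

definition slice_orthogonal_basis :: "nat \<Rightarrow> nat \<Rightarrow> ((nat \<Rightarrow> real) \<Rightarrow> real) set \<Rightarrow> bool" where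
  "slice_orthogonal_basis n k F \<longleftrightarrow>
     pairwise (\<lambda>f g. slice_inner n k f g = 0) F \<and>
     real_fun.independent F \<and>
     real_fun.span F = slice_functions n k"

text \<open>Sequences are lists, so the entry with index \<open>i\<close> in the usual 1-based numbering
  is the list element at position \<open>i - 1\<close>.\<close>

definition seqs :: "nat \<Rightarrow> nat \<Rightarrow> nat list set" where
  "seqs n d = {S. length S = d \<and> distinct S \<and> set S \<subseteq> {1..n}}"

definition seq_less :: "nat list \<Rightarrow> nat list \<Rightarrow> bool" where
  "seq_less A B \<longleftrightarrow> list_all2 (<) A B"

definition top_sets :: "nat \<Rightarrow> nat \<Rightarrow> nat list set" where
  "top_sets n d = {B \<in> seqs n d. sorted_wrt (<) B \<and>
     (\<exists>A \<in> seqs n d. set A \<inter> set B = {} \<and> seq_less A B)}"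

definition chi_pair :: "nat list \<Rightarrow> nat list \<Rightarrow> (nat \<Rightarrow> real) \<Rightarrow> real" where
  "chi_pair A B = (\<lambda>x. \<Prod>i<length B. x (A ! i) - x (B ! i))"

definition chi :: "nat \<Rightarrow> nat list \<Rightarrow> (nat \<Rightarrow> real) \<Rightarrow> real" where
  "chi n B = (\<lambda>x. \<Sum>A | A \<in> seqs n (length B) \<and> set A \<inter> set B = {} \<and> seq_less A B. chi_pair A B x)"

definition falling :: "nat \<Rightarrow> nat \<Rightarrow> real" where
  "falling m d = (\<Prod>i<d. real m - real i)"

text \<open>The shift to 0-based positions turns \<open>b\<^sub>i - 2(i - 1)\<close> into \<open>B ! i - 2 i\<close>.\<close>

definition c_top :: "nat list \<Rightarrow> real" where
  "c_top B = (\<Prod>i<length B.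
     (real (B ! i) - 2 * real i) * (real (B ! i) - 2 * real i - 1) / 2)"

end

theory Submission
  imports Defs
begin

text \<open>
  A sequence \<open>b\<^sub>1 < \<dots> < b\<^sub>d\<close> is a top set iff \<open>b\<^sub>i \<ge> 2 i\<close> for all \<open>i\<close>.  On 0/1 points,
  \<open>(x\<^sub>a - x\<^sub>b) (x\<^sub>a + x\<^sub>b) = x\<^sub>a - x\<^sub>b\<close>, and hence the sum over \<open>A\<close> factorises:
  \<open>\<chi>\<^sub>B\<close> is the product over \<open>i\<close> of
  \<open>(\<Sum>a<b\<^sub>i. x\<^sub>a) - (i - 1) - (b\<^sub>i - 2 i + 1) x\<close> with \<open>x\<close> taken at \<open>b\<^sub>i\<close>.
  Each factor depends only on the coordinates up to \<open>b\<^sub>i\<close>, and splitting the slice by the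
  value of its last coordinate gives a Pascal-type recursion in \<open>n\<close> for the unnormalised inner
  products, solved by \<open>c\<^sub>B 2\<^sup>d binomial (n - 2 d) (k - d)\<close> if \<open>B = B'\<close> and by \<open>0\<close> otherwise.
  Spanning follows because there are \<open>binomial n k\<close> top sets of length at most \<open>k\<close>.
\<close>

section \<open>Ballot sequences\<close>

text \<open>With entries in \<open>{1..n}\<close>, these are the second rows of two-row standard
  Young tableaux with \<open>n\<close> cells. The bound \<open>n\<close> is kept out of the
  predicate so that it can vary in inductions.\<close>

definition ballot :: "nat list \<Rightarrow> bool" where
  "ballot B \<longleftrightarrow> sorted_wrt (<) B \<and> (\<forall>i<length B. 2 * Suc i \<le> B ! i)"

lemma ballot_Nil [simp]: "ballot []"
  by (simp add: ballot_def)

lemma ballot_snoc: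
  "ballot (B @ [b]) \<longleftrightarrow> ballot B \<and> (\<forall>a\<in>set B. a < b) \<and> 2 * Suc (length B) \<le> b"
  unfolding ballot_def by (auto simp: sorted_wrt_append nth_append less_Suc_eq)

lemma ballot_length_le:
  assumes "ballot B" "set B \<subseteq> {1..n}"
  shows "2 * length B \<le> n"
  using assms by (cases B rule: rev_cases) (auto simp: ballot_snoc)

text \<open>Entries increase, so \<open>Suc n\<close> can only occur last. The strict bound
  \<open>2 * length B' < n\<close> is the ballot condition at that entry;
  \<open>bdiag_square\<close> relies on it.\<close>

lemma ballot_Suc_cases:
  assumes "ballot B" "set B \<subseteq> {1..Suc n}"
  obtains "set B \<subseteq> {1..n}"
  | B' where "B = B' @ [Suc n]" "ballot B'" "set B' \<subseteq> {1..n}" "2 * length B' < n"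
proof (cases B rule: rev_cases)
  case Nil
  then show ?thesis using that by simp
next
  case (snoc B' b)
  then have *: "ballot B'" "\<forall>a\<in>set B'. a < b" "2 * Suc (length B') \<le> b" "b \<le> Suc n"
    "set B' \<subseteq> {1..Suc n}"
    using assms by (auto simp: ballot_snoc)
  show ?thesis
  proof (cases "b = Suc n")
    case True
    have "set B' \<subseteq> {1..n}" using * True by fastforce
    then show ?thesis using that(2)[of B'] * True snoc by auto
  next
    case False
    then have "set B \<subseteq> {1..n}" using * snoc by fastforce
    then show ?thesis using that by blast
  qed
qed

text \<open>Greedy choice from left to right: when \<open>b\<close> is reached, at most
  \<open>2 * length B\<close> numbers are taken, while \<open>{1..<b}\<close> has at least one more,
  so a free \<open>a < b\<close> remains.\<close>

lemma ballot_extend: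
  assumes "ballot B"
  shows "\<exists>A. length A = length B \<and> distinct A \<and> set A \<inter> set B = {} \<and> seq_less A B \<and> 0 \<notin> set A"
  using assms
proof (induction B rule: rev_induct)
  case Nil
  then show ?case by (simp add: seq_less_def)
next
  case (snoc b B)
  then have B: "ballot B" "\<forall>a\<in>set B. a < b" "2 * Suc (length B) \<le> b"
    by (auto simp: ballot_snoc)
  then obtain A where A: "length A = length B" "distinct A" "set A \<inter> set B = {}"
    "seq_less A B" "0 \<notin> set A"
    using snoc.IH by blast
  have Ab: "\<forall>a\<in>set A. a < b"
    using A(4) B(2) unfolding seq_less_def list_all2_conv_all_nth
    by (metis in_set_conv_nth less_trans)
  have "card (set A \<union> set B) \<le> 2 * length B"
    using card_Un_le[of "set A" "set B"] card_length[of A] card_length[of B] A(1) by linarith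
  also have "\<dots> < card {1..<b}" using B(3) by simp
  finally have "\<not> {1..<b} \<subseteq> set A \<union> set B"
    using card_mono[of "set A \<union> set B" "{1..<b}"] by auto
  then obtain a where a: "a \<in> {1..<b}" "a \<notin> set A" "a \<notin> set B" by blast
  have "seq_less (A @ [a]) (B @ [b])"
    using A(1,4) a by (auto simp: seq_less_def list_all2_append)
  then show ?case
    using A a Ab B by (intro exI[of _ "A @ [a]"]) auto
qed

lemma top_sets_iff_ballot:
  "B \<in> top_sets n d \<longleftrightarrow> ballot B \<and> set B \<subseteq> {1..n} \<and> length B = d"
proof
  assume "B \<in> top_sets n d"
  then obtain A where B: "length B = d" "distinct B" "set B \<subseteq> {1..n}" "sorted_wrt (<) B"
    and A: "length A = d" "distinct A" "set A \<subseteq> {1..n}" "set A \<inter> set B = {}" "seq_less A B"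
    by (auto simp: top_sets_def seqs_def)
  have "2 * Suc i \<le> B ! i" if i: "i < length B" for i
  proof -
    \<comment> \<open>The entries of \<open>A\<close> and \<open>B\<close> up to position
      \<open>i\<close> are \<open>2 * Suc i\<close> distinct positive numbers, none of them above
      \<open>B ! i\<close>.\<close>
    let ?X = "set (take (Suc i) A) \<union> set (take (Suc i) B)"
    have le: "B ! j \<le> B ! i" if "j \<le> i" for j
      using sorted_wrt_nth_less[OF B(4), of j i] that i by (cases "j = i") auto
    have lt: "A ! j < B ! j" if "j \<le> i" for j
      using A(5) that i by (auto simp: seq_less_def list_all2_conv_all_nth)
    have "x \<le> B ! i" if "x \<in> ?X" for x
    proof -
      have "\<exists>j\<le>i. x = A ! j \<or> x = B ! j"
        using that by (fastforce simp: in_set_conv_nth less_Suc_eq_le)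
      then obtain j where "j \<le> i" "x = A ! j \<or> x = B ! j" by blast
      then show ?thesis using le[of j] lt[of j] by auto
    qed
    moreover have "x \<ge> 1" if "x \<in> ?X" for x
      using that A(3) B(3) by (auto dest!: in_set_takeD)
    ultimately have "?X \<subseteq> {1..B ! i}" by auto
    then have "card ?X \<le> B ! i" using card_mono[of "{1..B ! i}" ?X] by simp
    moreover have "card ?X = card (set (take (Suc i) A)) + card (set (take (Suc i) B))"
      using A(4) by (intro card_Un_disjoint) (auto dest!: in_set_takeD)
    moreover have "card (set (take (Suc i) A)) = Suc i" "card (set (take (Suc i) B)) = Suc i"
      using A(1,2) B(1,2) i by (simp_all add: distinct_card)
    ultimately show ?thesis by simp
  qed
  then show "ballot B \<and> set B \<subseteq> {1..n} \<and> length B = d"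
    using B by (auto simp: ballot_def)
next
  assume B: "ballot B \<and> set B \<subseteq> {1..n} \<and> length B = d"
  then obtain A where A: "length A = d" "distinct A" "set A \<inter> set B = {}" "seq_less A B"
    "0 \<notin> set A"
    using ballot_extend[of B] by auto
  have "set A \<subseteq> {1..n}"
  proof
    fix a assume a: "a \<in> set A"
    then obtain i where i: "i < d" "a = A ! i" using A(1) by (auto simp: in_set_conv_nth)
    then have "a < B ! i" "B ! i \<le> n"
      using A(4) B by (auto simp: seq_less_def list_all2_conv_all_nth subset_iff)
    moreover have "a \<noteq> 0" using a A(5) by metis
    ultimately show "a \<in> {1..n}" by auto
  qed
  moreover have "sorted_wrt (<) B" using B by (simp add: ballot_def)
  ultimately show "B \<in> top_sets n d"
    using A B strict_sorted_iff by (auto simp: top_sets_def seqs_def)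
qed

section \<open>Counting ballot sequences\<close>

lemma Union_top_sets:
  "(\<Union>d\<le>k. top_sets n d) = {B. ballot B \<and> set B \<subseteq> {1..n} \<and> length B \<le> k}"
  unfolding set_eq_iff UN_iff top_sets_iff_ballot by blast

lemma finite_ballots: "finite {B. ballot B \<and> set B \<subseteq> {1..n::nat} \<and> length B \<le> k}"
  by (rule finite_subset[OF _ finite_lists_length_le[of "{1..n}" k]]) blast+

text \<open>The boundary case \<open>2 * k = n + 1\<close> is included because the recursion passes from
  \<open>n + 1\<close> to \<open>n\<close> without lowering \<open>k\<close>.\<close>

lemma card_ballots:
  assumes "2 * k \<le> Suc n"
  shows "card {B. ballot B \<and> set B \<subseteq> {1..n} \<and> length B \<le> k} = n choose k"
  using assms
proof (induction n arbitrary: k)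
  case 0
  then have "k = 0" by simp
  moreover have "{B. ballot B \<and> set B \<subseteq> {1..0::nat} \<and> length B \<le> 0} = {[]}" by auto
  ultimately show ?case by simp
next
  case (Suc n)
  let ?V = "\<lambda>n k. {B. ballot B \<and> set B \<subseteq> {1..n::nat} \<and> length B \<le> k}"
  have main: "card (?V (Suc n) k) = Suc n choose k" if k: "2 * k \<le> Suc n" for k
  proof (cases k)
    case 0
    have "?V (Suc n) 0 = {[]}" by auto
    then show ?thesis using 0 by simp
  next
    case (Suc l)
    \<comment> \<open>Splitting by whether \<open>Suc n\<close> occurs as last entry mirrors
      Pascal's rule.\<close>
    have "?V (Suc n) (Suc l) = ?V n (Suc l) \<union> (\<lambda>B. B @ [Suc n]) ` ?V n l" (is "?L = ?R")
    proof (intro set_eqI iffI)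
      fix B assume "B \<in> ?L"
      then have "ballot B" "set B \<subseteq> {1..Suc n}" "length B \<le> Suc l" by auto
      from this(1,2) show "B \<in> ?R"
        by (cases rule: ballot_Suc_cases) (use \<open>ballot B\<close> \<open>length B \<le> Suc l\<close> in auto)
    next
      fix B assume "B \<in> ?R"
      then consider "B \<in> ?V n (Suc l)" | C where "B = C @ [Suc n]" "C \<in> ?V n l" by blast
      then show "B \<in> ?L"
      proof cases
        case 1
        then show ?thesis by auto
      next
        case 2
        moreover have "\<forall>a\<in>set C. a < Suc n" using 2 by auto
        ultimately show ?thesis using k Suc by (auto simp: ballot_snoc)
      qed
    qed
    moreover have "card ?R = card (?V n (Suc l)) + card ((\<lambda>B. B @ [Suc n]) ` ?V n l)"
      by (intro card_Un_disjoint finite_ballots finite_imageI) auto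
    moreover have "card ((\<lambda>B. B @ [Suc n]) ` ?V n l) = card (?V n l)"
      by (intro card_image inj_onI) auto
    ultimately show ?thesis using Suc.IH[of "Suc l"] Suc.IH[of l] k Suc by simp
  qed
  show ?case
  proof (cases "2 * k \<le> Suc n")
    case True
    then show ?thesis by (rule main)
  next
    \<comment> \<open>Now \<open>2 * k = n + 2\<close>, and a sequence of length \<open>k\<close>
      would need \<open>2 * k \<le> n + 1\<close>. So only lengths up to \<open>l = k - 1\<close>
      occur, and the binomials of \<open>2 * l + 1\<close> over \<open>l\<close> and over
      \<open>l + 1\<close> agree.\<close>
    case False
    then have l: "k = Suc (n div 2)" "n = 2 * (n div 2)" using Suc.prems by presburger+
    define l where "l = n div 2"
    have l: "k = Suc l" "n = 2 * l" using l by (simp_all add: l_def)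
    have "?V (Suc n) k = ?V (Suc n) l"
      using l ballot_length_le[of _ "Suc n"] by fastforce
    then have "card (?V (Suc n) k) = Suc n choose l" using main[of l] l by simp
    also have "\<dots> = Suc n choose k"
      using binomial_symmetric[of l "Suc n"] l by simp
    finally show ?thesis .
  qed
qed

section \<open>Product formula for the basis functions\<close>

text \<open>Free of \<open>n\<close>, in contrast to \<open>chi n B\<close>, so that one and the
  same function can be summed over slices of different dimensions.\<close>

definition chi_prod :: "nat list \<Rightarrow> (nat \<Rightarrow> real) \<Rightarrow> real" where
  "chi_prod B x = (\<Prod>i<length B.
     (\<Sum>a = 1..<B ! i. x a) - real i - (real (B ! i) - 2 * real i - 1) * x (B ! i))"

lemma chi_prod_Nil [simp]: "chi_prod [] x = 1"
  by (simp add: chi_prod_def)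

lemma chi_prod_snoc:
  "chi_prod (B @ [b]) x = chi_prod B x *
     ((\<Sum>a = 1..<b. x a) - real (length B) - (real b - 2 * real (length B) - 1) * x b)"
  by (simp add: chi_prod_def nth_append)

lemma chi_prod_cong:
  assumes "set B \<subseteq> {1..n}" "\<And>i. i \<in> {1..n} \<Longrightarrow> x i = y i"
  shows "chi_prod B x = chi_prod B y"
proof -
  have "B ! i \<in> {1..n}" if "i < length B" for i
    using assms(1) that by (meson nth_mem subsetD)
  then have "(\<Sum>a = 1..<B ! i. x a) = (\<Sum>a = 1..<B ! i. y a)" "x (B ! i) = y (B ! i)"
    if "i < length B" for i
    using that assms(2) by (fastforce intro!: sum.cong)+
  then show ?thesis unfolding chi_prod_def by (intro prod.cong) auto
qed

lemma c_top_snoc: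
  "c_top (B @ [b]) = c_top B *
     ((real b - 2 * real (length B)) * (real b - 2 * real (length B) - 1) / 2)"
  by (simp add: c_top_def nth_append)

lemma c_top_Nil [simp]: "c_top [] = 1"
  by (simp add: c_top_def)

text \<open>The ballot condition makes the two linear factors at least 2 and 1.\<close>

lemma c_top_pos: "ballot B \<Longrightarrow> c_top B > 0"
  unfolding c_top_def
proof (rule prod_pos)
  fix i assume "ballot B" "i \<in> {..<length B}"
  then have "2 * Suc i \<le> B ! i" by (auto simp: ballot_def)
  then have "real (2 * Suc i) \<le> real (B ! i)" by (simp only: of_nat_le_iff)
  then have "2 * real i + 2 \<le> real (B ! i)" by simp
  then show "0 < (real (B ! i) - 2 * real i) * (real (B ! i) - 2 * real i - 1) / 2" by simp
qed

text \<open>On 0/1 points a nonzero factor of \<open>chi_pair A B\<close> forces its two coordinates to sum to 1.\<close>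

lemma chi_pair_mult_sum:
  assumes "length A = length B" "distinct A" "distinct B" "set A \<inter> set B = {}"
    and "\<And>i. i \<in> set A \<union> set B \<Longrightarrow> x i \<in> {0, 1}"
  shows "chi_pair A B x * (\<Sum>i\<in>set A \<union> set B. x i) = chi_pair A B x * real (length B)"
proof (cases "chi_pair A B x = 0")
  case False
  have sum: "(\<Sum>i\<in>set xs. x i) = (\<Sum>i<length xs. x (xs ! i))" if "distinct xs" for xs
    using that by (simp add: sum.distinct_set_conv_list sum_list_sum_nth atLeast0LessThan)
  have one: "x (A ! i) + x (B ! i) = 1" if i: "i < length B" for i
  proof -
    have "x (A ! i) - x (B ! i) \<noteq> 0"
      using False i by (auto simp: chi_pair_def)
    moreover have "x (A ! i) \<in> {0, 1}" "x (B ! i) \<in> {0, 1}"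
      using assms(1,5) i by auto
    ultimately show ?thesis by auto
  qed
  have "(\<Sum>i\<in>set A \<union> set B. x i) = (\<Sum>i\<in>set A. x i) + (\<Sum>i\<in>set B. x i)"
    using assms(4) by (simp add: sum.union_disjoint)
  also have "\<dots> = (\<Sum>i<length B. x (A ! i) + x (B ! i))"
    using assms(1-3) by (simp add: sum sum.distrib)
  also have "\<dots> = real (length B)" using one by simp
  finally show ?thesis by simp
qed simp

text \<open>For fixed \<open>A\<close>, the admissible last entries are the
  \<open>b - 1 - 2 * length B\<close> elements of \<open>{1..<b}\<close> outside \<open>A\<close>
  and \<open>B\<close>. Summing \<open>x a - x b\<close> over them gives a factor that depends on
  \<open>A\<close> only through the coordinate sum over \<open>A\<close> and \<open>B\<close>, and
  \<open>chi_pair_mult_sum\<close> makes that sum a constant.\<close>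

lemma chi_snoc:
  assumes "ballot (B @ [b])" "set B \<subseteq> {1..n}" "b \<le> n" "\<And>i. i \<in> {1..n} \<Longrightarrow> x i \<in> {0, 1}"
  shows "chi n (B @ [b]) x = chi n B x *
     ((\<Sum>a = 1..<b. x a) - real (length B) - (real b - 2 * real (length B) - 1) * x b)"
proof -
  let ?W = "\<lambda>B. {A. A \<in> seqs n (length B) \<and> set A \<inter> set B = {} \<and> seq_less A B}"
  let ?S = "\<lambda>A. {1..<b} - (set A \<union> set B)"
  have B: "\<forall>a\<in>set B. a < b" "2 * Suc (length B) \<le> b" "distinct B"
    using assms(1) unfolding ballot_snoc by (auto simp: ballot_def strict_sorted_iff)
  have finW: "finite (?W B)"
    by (rule finite_subset[OF _ finite_lists_length_eq[of "{1..n}" "length B"]])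
      (auto simp: seqs_def)
  have lt: "a < b" if "A \<in> ?W B" "a \<in> set A" for A a
    using that B(1) unfolding seq_less_def list_all2_conv_all_nth
    by (auto simp: in_set_conv_nth) (metis nth_mem less_trans)
  have W: "?W (B @ [b]) = (\<lambda>(A, a). A @ [a]) ` (SIGMA A:?W B. ?S A)" (is "?L = ?R")
  proof (intro set_eqI iffI)
    fix A' assume A': "A' \<in> ?L"
    then obtain A a where Aa: "A' = A @ [a]" "length A = length B"
      by (cases A' rule: rev_cases) (auto simp: seqs_def)
    then have "A \<in> ?W B" "a \<in> ?S A"
      using A' by (auto simp: seqs_def seq_less_def list_all2_append)
    then show "A' \<in> ?R" using Aa(1) by force
  next
    fix A' assume "A' \<in> ?R"
    then obtain z where z: "A' = (case z of (A, a) \<Rightarrow> A @ [a])" "z \<in> (SIGMA A:?W B. ?S A)"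
      by (rule imageE)
    obtain A a where "z = (A, a)" by (cases z)
    with z have "A' = A @ [a]" "A \<in> ?W B" "a \<in> ?S A"
      by (simp_all only: mem_Sigma_iff prod.case)
    then show "A' \<in> ?L"
      using lt[of A] assms(3) B by (fastforce simp: seqs_def seq_less_def list_all2_append)
  qed
  have step: "(\<Sum>a\<in>?S A. chi_pair (A @ [a]) (B @ [b]) x) = chi_pair A B x *
     ((\<Sum>a = 1..<b. x a) - real (length B) - (real b - 2 * real (length B) - 1) * x b)"
    if A: "A \<in> ?W B" for A
  proof -
    have A': "length A = length B" "distinct A" "set A \<inter> set B = {}" "set A \<subseteq> {1..n}"
      using A by (auto simp: seqs_def)
    have sub: "set A \<union> set B \<subseteq> {1..<b}"
      using lt[OF A] B(1) A'(4) assms(2) by fastforce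
    have "card (set A \<union> set B) = 2 * length B"
      using A' B(3) by (simp add: card_Un_disjoint distinct_card)
    then have card: "real (card (?S A)) = real b - 2 * real (length B) - 1"
      using sub B(2) by (simp add: card_Diff_subset of_nat_diff)
    have pair: "chi_pair (A @ [a]) (B @ [b]) x = chi_pair A B x * (x a - x b)" for a
      using A'(1) by (simp add: chi_pair_def nth_append)
    have "(\<Sum>a\<in>?S A. chi_pair (A @ [a]) (B @ [b]) x) =
        chi_pair A B x * ((\<Sum>a\<in>?S A. x a) - real (card (?S A)) * x b)"
      by (simp add: pair sum_distrib_left[symmetric] sum_subtractf)
    also have "(\<Sum>a\<in>?S A. x a) = (\<Sum>a = 1..<b. x a) - (\<Sum>a\<in>set A \<union> set B. x a)"
      using sub by (simp add: sum_diff)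
    also have "chi_pair A B x * ((\<Sum>a = 1..<b. x a) - (\<Sum>a\<in>set A \<union> set B. x a)
          - real (card (?S A)) * x b) =
        chi_pair A B x * ((\<Sum>a = 1..<b. x a) - real (card (?S A)) * x b)
          - chi_pair A B x * (\<Sum>a\<in>set A \<union> set B. x a)"
      by (simp add: algebra_simps)
    \<comment> \<open>Here the 0/1 values enter: the last trace of \<open>A\<close> in the new
      factor disappears.\<close>
    also have "chi_pair A B x * (\<Sum>a\<in>set A \<union> set B. x a) = chi_pair A B x * real (length B)"
      using A' B(3) assms(2,4) by (intro chi_pair_mult_sum) blast+
    finally show ?thesis unfolding card by (simp add: algebra_simps)
  qed
  have "chi n (B @ [b]) x = (\<Sum>A\<in>?R. chi_pair A (B @ [b]) x)"
    unfolding chi_def W[symmetric] by simp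
  also have "\<dots> = (\<Sum>(A, a)\<in>(SIGMA A:?W B. ?S A). chi_pair (A @ [a]) (B @ [b]) x)"
    by (subst sum.reindex) (auto simp: inj_on_def case_prod_beta)
  also have "\<dots> = (\<Sum>A\<in>?W B. \<Sum>a\<in>?S A. chi_pair (A @ [a]) (B @ [b]) x)"
    using finW by (subst sum.Sigma) auto
  also have "\<dots> = (\<Sum>A\<in>?W B. chi_pair A B x *
     ((\<Sum>a = 1..<b. x a) - real (length B) - (real b - 2 * real (length B) - 1) * x b))"
    using step by (intro sum.cong) auto
  finally show ?thesis by (simp add: chi_def sum_distrib_right)
qed

lemma chi_eq_chi_prod:
  assumes "ballot B" "set B \<subseteq> {1..n}" "\<And>i. i \<in> {1..n} \<Longrightarrow> x i \<in> {0, 1}"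
  shows "chi n B x = chi_prod B x"
  using assms(1,2)
proof (induction B rule: rev_induct)
  case Nil
  have "{A. A \<in> seqs n 0 \<and> set A \<inter> set [] = {} \<and> seq_less A []} = {[]}"
    by (auto simp: seqs_def seq_less_def)
  then show ?case by (simp add: chi_def chi_pair_def)
next
  case (snoc b B)
  then show ?case
    using assms(3) by (subst chi_snoc) (auto simp: chi_prod_snoc ballot_snoc)
qed

section \<open>Inner products by revealing the last coordinate\<close>

lemma finite_slice: "finite (slice n k)"
  unfolding slice_def by (rule finite_subset[OF _ finite_PiE[of "{1..n}" "\<lambda>_. {0, 1}"]]) auto

lemma slice_01: "x \<in> slice n k \<Longrightarrow> i \<in> {1..n} \<Longrightarrow> x i \<in> {0, 1}"
  by (auto simp: slice_def)

lemma slice_0: "slice 0 k = (if k = 0 then {\<lambda>_. undefined} else {})"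
  by (auto simp: slice_def)

text \<open>The guard is essential: for \<open>k = 0\<close> truncated subtraction would turn
  \<open>slice n (k - 1)\<close> into the nonempty \<open>slice n 0\<close>.\<close>

lemma slice_Suc:
  "slice (Suc n) k = (\<lambda>x. x(Suc n := 0)) ` slice n k \<union>
     (if k = 0 then {} else (\<lambda>x. x(Suc n := 1)) ` slice n (k - 1))" (is "_ = ?R")
proof (intro set_eqI iffI)
  have upd: "(\<Sum>i = 1..Suc n. (x(Suc n := v)) i) = (\<Sum>i = 1..n. x i) + v" for x :: "nat \<Rightarrow> real" and v
    by simp
  fix x
  {
    assume x: "x \<in> slice (Suc n) k"
    then have "x \<in> {1..Suc n} \<rightarrow>\<^sub>E {0, 1}" by (simp add: slice_def)
    then have "x \<in> insert (Suc n) {1..n} \<rightarrow>\<^sub>E {0, 1}"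
      by (simp add: atLeastAtMostSuc_conv)
    then obtain v g where g: "x = g(Suc n := v)" "v \<in> {0, 1}" "g \<in> {1..n} \<rightarrow>\<^sub>E {0, 1}"
      unfolding PiE_insert_eq by auto
    have s: "(\<Sum>i = 1..n. g i) + v = real k"
      using x upd[of g v] g(1) by (simp add: slice_def)
    \<comment> \<open>Nonnegativity excludes \<open>v = 1\<close> when \<open>k = 0\<close>.\<close>
    have nn: "0 \<le> (\<Sum>i = 1..n. g i)"
      using g(3) by (intro sum_nonneg) (auto dest: PiE_mem)
    show "x \<in> ?R"
    proof (cases "v = 0")
      case True
      then have "g \<in> slice n k" using s g by (simp add: slice_def)
      then show ?thesis using g True by auto
    next
      case False
      then have "v = 1" "k \<noteq> 0" using g s nn by auto
      then have "g \<in> slice n (k - 1)" using s g by (simp add: slice_def of_nat_diff)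
      then show ?thesis using g \<open>v = 1\<close> \<open>k \<noteq> 0\<close> by auto
    qed
  next
    assume "x \<in> ?R"
    then obtain v g where g: "x = g(Suc n := v)" "v \<in> {0, 1}" "g \<in> {1..n} \<rightarrow>\<^sub>E {0, 1}"
      "(\<Sum>i = 1..n. g i) + v = real k"
      by (auto simp: slice_def of_nat_diff split: if_splits)
    have "x \<in> insert (Suc n) {1..n} \<rightarrow>\<^sub>E {0, 1}"
      unfolding PiE_insert_eq using g(1-3) by auto
    then have "x \<in> {1..Suc n} \<rightarrow>\<^sub>E {0, 1}"
      by (simp add: atLeastAtMostSuc_conv)
    then show "x \<in> slice (Suc n) k"
      using g(1,4) upd[of g v] by (simp add: slice_def)
  }
qed

lemma sum_slice_Suc:
  "(\<Sum>x\<in>slice (Suc n) k. f x) = (\<Sum>x\<in>slice n k. f (x(Suc n := 0))) +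
     (if k = 0 then 0 else \<Sum>x\<in>slice n (k - 1). f (x(Suc n := 1)))"
proof -
  \<comment> \<open>Points of \<open>slice n l\<close> are extensional, hence all
    \<open>undefined\<close> at \<open>Suc n\<close>; overwriting that value loses nothing.\<close>
  have inj: "inj_on (\<lambda>x. x(Suc n := v)) (slice n l)" for v l
  proof (rule inj_onI)
    fix x y assume xy: "x \<in> slice n l" "y \<in> slice n l" "x(Suc n := v) = y(Suc n := v)"
    then have "x (Suc n) = undefined" "y (Suc n) = undefined"
      by (auto simp: slice_def PiE_def extensional_def)
    then show "x = y" using xy(3) by (metis fun_upd_triv fun_upd_upd)
  qed
  have disj: "(\<lambda>x. x(Suc n := 0)) ` slice n k \<inter> (\<lambda>x. x(Suc n := 1)) ` slice n l = {}" for l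
    by (auto dest: fun_cong[of _ _ "Suc n"])
  show ?thesis
    unfolding slice_Suc using disj
    by (auto simp: sum.union_disjoint finite_slice sum.reindex[OF inj])
qed

section \<open>Binomial identities for the diagonal values\<close>

text \<open>For \<open>d > k\<close> truncated subtraction would yield a binomial coefficient 1
  instead of 0. \<open>bdiag_pred\<close> likewise treats level -1 as empty.\<close>

definition bdiag :: "nat \<Rightarrow> nat \<Rightarrow> nat \<Rightarrow> real" where
  "bdiag n k d = (if d \<le> k then real ((n - 2 * d) choose (k - d)) else 0)"

definition bdiag_pred :: "nat \<Rightarrow> nat \<Rightarrow> nat \<Rightarrow> real" where
  "bdiag_pred n k d = (if k = 0 then 0 else bdiag n (k - 1) d)"

lemma bdiag_Suc:
  assumes "2 * d \<le> n"
  shows "bdiag (Suc n) k d = bdiag n k d + bdiag_pred n k d"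
proof (cases "d < k")
  case True
  then obtain j where j: "k = Suc (d + j)" using less_imp_Suc_add by blast
  then show ?thesis using assms by (simp add: bdiag_def bdiag_pred_def Suc_diff_le)
qed (auto simp: bdiag_def bdiag_pred_def)

text \<open>For \<open>d < k\<close> put \<open>M = n - 2 * d\<close> and
  \<open>j = k - d - 1\<close>: by the two absorption identities, both sides equal
  \<open>M * ((M - 1) choose j)\<close>.\<close>

lemma bdiag_balance:
  assumes "2 * d \<le> n"
  shows "(real k - real d) * bdiag n k d = (real n + 1 - real k - real d) * bdiag_pred n k d"
proof (cases "d < k")
  case True
  then obtain j where j: "k = Suc (d + j)" using less_imp_Suc_add by blast
  obtain M where M: "n = 2 * d + M" using assms le_Suc_ex by blast
  have "real (Suc j) * real (M choose Suc j) = (real M - real j) * real (M choose j)"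
  proof (cases "j \<le> M")
    case True
    have "Suc j * (M choose Suc j) = (M - j) * (M choose j)"
      by (metis binomial_absorption binomial_absorb_comp)
    then show ?thesis using True by (metis of_nat_diff of_nat_mult)
  qed (simp add: binomial_eq_0)
  then show ?thesis using j M by (simp add: bdiag_def bdiag_pred_def algebra_simps)
qed (auto simp: bdiag_def bdiag_pred_def)

text \<open>Absorption once more, now read as a passage from length \<open>d\<close> to
  \<open>Suc d\<close>. Strictness of \<open>2 * d < n\<close> keeps
  \<open>Suc n - 2 * Suc d\<close> from being truncated.\<close>

lemma bdiag_absorb:
  assumes "2 * d < n"
  shows "(real k - real d) * bdiag n k d = (real n - 2 * real d) * bdiag (Suc n) k (Suc d)"
proof (cases "d < k")
  case True
  then obtain j where j: "k = Suc (d + j)" using less_imp_Suc_add by blast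
  obtain M where M: "n = Suc (2 * d + M)" using assms less_imp_Suc_add by blast
  have "Suc j * (Suc M choose Suc j) = Suc M * (M choose j)"
    using binomial_absorption[of j "Suc M"] by simp
  then have "real (Suc j) * real (Suc M choose Suc j) = real (Suc M) * real (M choose j)"
    by (metis of_nat_mult)
  then show ?thesis using j M by (simp add: bdiag_def del: binomial_Suc_Suc)
qed (auto simp: bdiag_def)

text \<open>By \<open>bdiag_balance\<close> the two summands are \<open>u * t\<close> and
  \<open>v * t\<close> with the same \<open>t\<close>, and \<open>u + v = n + 1 - 2 * d\<close>. The
  resulting factors \<open>(n + 1 - 2 * d) * (n - 2 * d)\<close> are what \<open>c_top\<close> and
  the power of 2 gain when \<open>Suc n\<close> is appended.\<close>

lemma bdiag_square:
  assumes "2 * d < n"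
  shows "(real k - real d)\<^sup>2 * bdiag n k d + (real n + 1 - real k - real d)\<^sup>2 * bdiag_pred n k d
    = (real n + 1 - 2 * real d) * (real n - 2 * real d) * bdiag (Suc n) k (Suc d)"
proof -
  let ?u = "real k - real d" and ?v = "real n + 1 - real k - real d"
  have "?u\<^sup>2 * bdiag n k d + ?v\<^sup>2 * bdiag_pred n k d
      = ?u * (?u * bdiag n k d) + ?v * (?v * bdiag_pred n k d)"
    by (simp add: power2_eq_square)
  also have "\<dots> = (?u + ?v) * (?u * bdiag n k d)"
    unfolding bdiag_balance[OF less_imp_le[OF assms], symmetric] by (simp add: algebra_simps)
  also have "\<dots> = (real n + 1 - 2 * real d) * (?u * bdiag n k d)" by simp
  also have "?u * bdiag n k d = (real n - 2 * real d) * bdiag (Suc n) k (Suc d)"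
    using assms by (rule bdiag_absorb)
  finally show ?thesis by simp
qed

section \<open>Recursion for the unnormalised inner products\<close>

definition slice_sum :: "nat \<Rightarrow> nat \<Rightarrow> nat list \<Rightarrow> nat list \<Rightarrow> real" where
  "slice_sum n k B B' = (\<Sum>x\<in>slice n k. chi_prod B x * chi_prod B' x)"

lemma chi_prod_upd:
  assumes "set B \<subseteq> {1..n}"
  shows "chi_prod B (x(Suc n := v)) = chi_prod B x"
  using assms by (intro chi_prod_cong) auto

text \<open>On a slice the first \<open>n\<close> coordinates sum to a constant, so the last factor
  is constant on each half of the split. At level \<open>k\<close> with \<open>v = 0\<close> it is
  \<open>k - d\<close>; at level \<open>k - 1\<close> with \<open>v = 1\<close> it is
  \<open>-(n + 1 - k - d)\<close>, where \<open>d\<close> is the length of \<open>B\<close>. These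
  are the weights in the recursions below.\<close>

lemma chi_prod_snoc_upd:
  assumes "set B \<subseteq> {1..n}" "x \<in> slice n k"
  shows "chi_prod (B @ [Suc n]) (x(Suc n := v)) = chi_prod B x *
    (real k - real (length B) - (real n - 2 * real (length B)) * v)"
proof -
  have "(\<Sum>a = 1..<Suc n. (x(Suc n := v)) a) = (\<Sum>a = 1..n. x a)"
    by (intro sum.cong) auto
  also have "\<dots> = real k" using assms(2) by (simp add: slice_def)
  finally show ?thesis
    using assms(1) by (simp add: chi_prod_snoc chi_prod_upd)
qed

lemma slice_sum_commute: "slice_sum n k B B' = slice_sum n k B' B"
  by (simp add: slice_sum_def mult.commute)

lemma slice_sum_Suc:
  assumes "set B \<subseteq> {1..n}" "set B' \<subseteq> {1..n}"
  shows "slice_sum (Suc n) k B B' = slice_sum n k B B' +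
    (if k = 0 then 0 else slice_sum n (k - 1) B B')"
  using assms by (simp add: slice_sum_def sum_slice_Suc chi_prod_upd)

lemma slice_sum_Suc_snoc:
  assumes "set B \<subseteq> {1..n}" "set B' \<subseteq> {1..n}"
  shows "slice_sum (Suc n) k (B @ [Suc n]) B' =
    (real k - real (length B)) * slice_sum n k B B' -
    (real n + 1 - real k - real (length B)) * (if k = 0 then 0 else slice_sum n (k - 1) B B')"
proof -
  have 0: "chi_prod (B @ [Suc n]) (x(Suc n := 0)) * chi_prod B' (x(Suc n := 0)) =
      (real k - real (length B)) * (chi_prod B x * chi_prod B' x)" if "x \<in> slice n k" for x
    using assms that by (simp add: chi_prod_snoc_upd chi_prod_upd)
  have 1: "chi_prod (B @ [Suc n]) (x(Suc n := 1)) * chi_prod B' (x(Suc n := 1)) =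
      - (real n + 1 - real k - real (length B)) * (chi_prod B x * chi_prod B' x)"
    if "x \<in> slice n (k - 1)" "k \<noteq> 0" for x
    using assms that by (simp add: chi_prod_snoc_upd chi_prod_upd of_nat_diff)
  show ?thesis
    unfolding slice_sum_def sum_slice_Suc
    by (cases "k = 0") (simp_all only: 0 1 sum_distrib_left mult_minus_left sum_negf simp_thms
        if_True if_False mult_zero_right diff_zero add_0_right add_uminus_conv_diff cong: sum.cong)
qed

lemma slice_sum_Suc_snoc_snoc:
  assumes "set B \<subseteq> {1..n}" "set B' \<subseteq> {1..n}"
  shows "slice_sum (Suc n) k (B @ [Suc n]) (B' @ [Suc n]) =
    (real k - real (length B)) * (real k - real (length B')) * slice_sum n k B B' +
    (real n + 1 - real k - real (length B)) * (real n + 1 - real k - real (length B')) *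
      (if k = 0 then 0 else slice_sum n (k - 1) B B')"
proof -
  let ?u = "\<lambda>B. real k - real (length B)"
  let ?v = "\<lambda>B. real n + 1 - real k - real (length B)"
  have 0: "chi_prod (B @ [Suc n]) (x(Suc n := 0)) * chi_prod (B' @ [Suc n]) (x(Suc n := 0)) =
      ?u B * ?u B' * (chi_prod B x * chi_prod B' x)" if "x \<in> slice n k" for x
    using assms that by (simp add: chi_prod_snoc_upd)
  have 1: "chi_prod (B @ [Suc n]) (x(Suc n := 1)) * chi_prod (B' @ [Suc n]) (x(Suc n := 1)) =
      ?v B * ?v B' * (chi_prod B x * chi_prod B' x)"
    if "x \<in> slice n (k - 1)" "k \<noteq> 0" for x
  proof -
    have "chi_prod (C @ [Suc n]) (x(Suc n := 1)) = - (?v C) * chi_prod C x"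
      if "set C \<subseteq> {1..n}" for C
      using chi_prod_snoc_upd[OF that \<open>x \<in> slice n (k - 1)\<close>] \<open>k \<noteq> 0\<close> by (simp add: of_nat_diff)
    then show ?thesis using assms by (simp del: minus_diff_eq)
  qed
  show ?thesis
    by (cases "k = 0") (simp_all add: slice_sum_def sum_slice_Suc 0 1 sum_distrib_left)
qed

text \<open>The vanishing of the mixed term, where only one of the two sequences ends in the last
  coordinate, is exactly \<open>bdiag_balance\<close>.\<close>

lemma slice_sum_eq:
  assumes "ballot B" "set B \<subseteq> {1..n}" "ballot B'" "set B' \<subseteq> {1..n}"
  shows "slice_sum n k B B' =
    (if B = B' then c_top B * 2 ^ length B * bdiag n k (length B) else 0)"
  using assms
proof (induction n arbitrary: k B B')
  \<comment> \<open>Only empty sequences fit into \<open>{1..0}\<close>, and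
    \<open>0 choose k\<close> is 1 exactly when \<open>slice 0 k\<close> has its single
    point.\<close>
  case 0
  then show ?case by (simp add: slice_sum_def slice_0 bdiag_def)
next
  case (Suc n)
  have pred: "(if k = 0 then 0 else slice_sum n (k - 1) C C') =
      (if C = C' then c_top C * 2 ^ length C * bdiag_pred n k (length C) else 0)"
    if "ballot C" "set C \<subseteq> {1..n}" "ballot C'" "set C' \<subseteq> {1..n}" for C C'
    using Suc.IH[OF that] by (auto simp: bdiag_pred_def)
  have mixed: "slice_sum (Suc n) k (C @ [Suc n]) C' = 0"
    if C: "ballot C" "set C \<subseteq> {1..n}" "ballot C'" "set C' \<subseteq> {1..n}" for C C'
    unfolding slice_sum_Suc_snoc[OF C(2,4)] pred[OF C] unfolding Suc.IH[OF C]
    using arg_cong[OF bdiag_balance[OF ballot_length_le[OF C(1,2)], of k],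
        of "\<lambda>t. c_top C * 2 ^ length C * t"]
    by (cases "C = C'") (simp_all add: mult.left_commute)
  show ?case
    using Suc.prems(1,2)
  proof (cases rule: ballot_Suc_cases)
    case B: 1
    show ?thesis
      using Suc.prems(3,4)
    proof (cases rule: ballot_Suc_cases)
      case B': 1
      show ?thesis
        unfolding slice_sum_Suc[OF B B'] pred[OF Suc.prems(1) B Suc.prems(3) B']
        unfolding Suc.IH[OF Suc.prems(1) B Suc.prems(3) B']
        using bdiag_Suc[OF ballot_length_le[OF Suc.prems(1) B], of k]
        by (auto simp: algebra_simps)
    next
      case B': (2 C')
      have "B \<noteq> B'" using B B' by auto
      then show ?thesis
        using mixed[OF B'(2,3) Suc.prems(1) B] B'(1) slice_sum_commute by simp
    qed
  next
    case B: (2 C)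
    show ?thesis
      using Suc.prems(3,4)
    proof (cases rule: ballot_Suc_cases)
      case B': 1
      have "B \<noteq> B'" using B B' by auto
      then show ?thesis
        using mixed[OF B(2,3) Suc.prems(3) B'] B(1) by simp
    next
      case B': (2 C')
      \<comment> \<open>Both sequences end in \<open>Suc n\<close>, so they agree iff
        \<open>C = C'\<close>; the diagonal term has the shape of
        \<open>bdiag_square\<close>.\<close>
      have rec: "slice_sum (Suc n) k B B' = (if C = C' then c_top C * 2 ^ length C *
          ((real k - real (length C))\<^sup>2 * bdiag n k (length C) +
           (real n + 1 - real k - real (length C))\<^sup>2 * bdiag_pred n k (length C)) else 0)"
        unfolding B(1) B'(1) slice_sum_Suc_snoc_snoc[OF B(3) B'(3)]
          pred[OF B(2,3) B'(2,3)]
        unfolding Suc.IH[OF B(2,3) B'(2,3)]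
        by (simp add: power2_eq_square algebra_simps)
      show ?thesis
        unfolding rec bdiag_square[OF B(4)] by (simp add: B(1) B'(1) c_top_snoc)
    qed
  qed
qed

section \<open>Normalisation by the size of the slice\<close>

text \<open>The instance of \<open>slice_sum_eq\<close> at two empty sequences, where the summand is
  1.\<close>

lemma card_slice: "card (slice n k) = n choose k"
proof -
  have "real (card (slice n k)) = real (n choose k)"
    using slice_sum_eq[of "[]" n "[]" k] by (simp add: slice_sum_def bdiag_def)
  then show ?thesis by simp
qed

text \<open>The bound \<open>k \<le> n\<close> makes the slice nonempty, so that the uniform
  distribution on it is meaningful.\<close>

lemma slice_inner_eq_sum:
  assumes "k \<le> n"
  shows "slice_inner n k f g = (\<Sum>x\<in>slice n k. f x * g x) / real (n choose k)"
proof -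
  have "slice n k \<noteq> {}" using card_slice[of n k] assms by (metis binomial_eq_0_iff card.empty not_less)
  then show ?thesis
    by (simp add: slice_inner_def integral_pmf_of_set finite_slice card_slice)
qed

lemma falling_eq_fact: "d \<le> m \<Longrightarrow> falling m d = fact m / fact (m - d)"
proof (induction d)
  case (Suc d)
  then have "m - d = Suc (m - Suc d)" by simp
  then have f: "(fact (m - d) :: real) = (real m - real d) * fact (m - Suc d)"
    using Suc.prems by (simp add: of_nat_diff)
  have "falling m (Suc d) = fact m / fact (m - d) * (real m - real d)"
    using Suc by (simp add: falling_def)
  then show ?case using Suc.prems by (simp add: f)
qed (simp add: falling_def)

lemma binomial_ratio_falling:
  assumes "d \<le> k" "d \<le> n - k" "k \<le> n"
  shows "real ((n - 2 * d) choose (k - d)) / real (n choose k) =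
    falling k d * falling (n - k) d / falling n (2 * d)"
proof -
  have "n - 2 * d - (k - d) = n - k - d" using assms by simp
  then have "real ((n - 2 * d) choose (k - d)) =
      fact (n - 2 * d) / (fact (k - d) * fact (n - k - d))"
    using assms by (subst binomial_fact) auto
  moreover have "real (n choose k) = fact n / (fact k * fact (n - k))"
    using assms by (simp add: binomial_fact)
  ultimately show ?thesis using assms by (simp add: falling_eq_fact)
qed

lemma slice_inner_chi:
  assumes "2 * k \<le> n"
    and "ballot B" "set B \<subseteq> {1..n}" "length B \<le> k" "ballot B'" "set B' \<subseteq> {1..n}"
  shows "slice_inner n k (slice_restrict n k (chi n B)) (slice_restrict n k (chi n B')) =
    (if B = B' then c_top B * 2 ^ length B *
       (falling k (length B) * falling (n - k) (length B) / falling n (2 * length B)) else 0)"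
proof -
  have "(\<Sum>x\<in>slice n k. slice_restrict n k (chi n B) x * slice_restrict n k (chi n B') x)
      = slice_sum n k B B'"
    unfolding slice_sum_def
  proof (rule sum.cong[OF refl])
    fix x assume x: "x \<in> slice n k"
    then have "chi n C x = chi_prod C x" if "ballot C" "set C \<subseteq> {1..n}" for C
      using that slice_01 by (intro chi_eq_chi_prod) blast+
    then show "slice_restrict n k (chi n B) x * slice_restrict n k (chi n B') x =
        chi_prod B x * chi_prod B' x"
      using x assms by (simp add: slice_restrict_def)
  qed
  then have "slice_inner n k (slice_restrict n k (chi n B)) (slice_restrict n k (chi n B')) =
      (if B = B' then c_top B * 2 ^ length B *
        (real ((n - 2 * length B) choose (k - length B)) / real (n choose k)) else 0)"
    using assms by (auto simp: slice_inner_eq_sum slice_sum_eq bdiag_def)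
  moreover have "real ((n - 2 * length B) choose (k - length B)) / real (n choose k) =
      falling k (length B) * falling (n - k) (length B) / falling n (2 * length B)"
    using assms by (intro binomial_ratio_falling) auto
  ultimately show ?thesis by (simp only:)
qed

section \<open>Orthogonality to basis\<close>

lemma sum_fun_apply: "(\<Sum>i\<in>I. f i) x = (\<Sum>i\<in>I. f i x :: 'b :: comm_monoid_add)"
  by (induction I rule: infinite_finite_induct) auto

text \<open>Point masses provide a spanning set with at most \<open>n choose k\<close> elements,
  which bounds the dimension from above.\<close>

lemma slice_functions_subset_span:
  "slice_functions n k \<subseteq> real_fun.span ((\<lambda>x y. if y = x then 1 else 0) ` slice n k)"
proof
  fix f assume f: "f \<in> slice_functions n k"
  have "f = (\<Sum>x\<in>slice n k. (\<lambda>y. f x * (if y = x then 1 else 0)))"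
  proof
    fix y
    have "(\<Sum>x\<in>slice n k. f x * (if y = x then 1 else 0)) = (if y \<in> slice n k then f y else 0)"
      by (simp add: finite_slice if_distrib[of "(*) _"] cong: if_cong)
    then show "f y = (\<Sum>x\<in>slice n k. (\<lambda>y. f x * (if y = x then 1 else 0))) y"
      using f by (auto simp: sum_fun_apply slice_functions_def)
  qed
  also have "\<dots> \<in> real_fun.span ((\<lambda>x y. if y = x then 1 else 0) ` slice n k)"
    by (intro real_fun.span_sum real_fun.span_scale real_fun.span_base) auto
  finally show "f \<in> real_fun.span ((\<lambda>x y. if y = x then 1 else 0) ` slice n k)" .
qed

lemma subspace_slice_functions: "real_fun.subspace (slice_functions n k)"
  by (rule real_fun.subspaceI) (auto simp: slice_functions_def)

text \<open>Pairing a linear relation with one of its members isolates that coefficient, hence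
  independence. A slice function outside the span could be added to \<open>F\<close>, giving more
  independent elements than there are point masses.\<close>

lemma slice_orthogonal_basisI:
  assumes "k \<le> n" and sub: "F \<subseteq> slice_functions n k" and "finite F"
    and orth: "pairwise (\<lambda>f g. slice_inner n k f g = 0) F"
    and nz: "\<And>f. f \<in> F \<Longrightarrow> slice_inner n k f f \<noteq> 0"
    and card: "card F = n choose k"
  shows "slice_orthogonal_basis n k F"
proof -
  have ind: "real_fun.independent F"
  proof
    assume "real_fun.dependent F"
    then obtain t u where t: "finite t" "t \<subseteq> F" "(\<Sum>f\<in>t. (\<lambda>x. u f * f x)) = 0"
      and "\<exists>v\<in>t. u v \<noteq> 0"
      unfolding real_fun.dependent_explicit by blast
    then obtain v where v: "v \<in> t" "u v \<noteq> 0" by blast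
    have "(\<Sum>f\<in>t. u f * f x) = 0" for x
      using fun_cong[OF t(3), of x] by (simp add: sum_fun_apply)
    then have "0 = (\<Sum>x\<in>slice n k. (\<Sum>f\<in>t. u f * f x) * v x) / real (n choose k)" by simp
    also have "\<dots> = (\<Sum>f\<in>t. u f * slice_inner n k f v)"
      unfolding slice_inner_eq_sum[OF assms(1)] sum_distrib_right sum_distrib_left sum_divide_distrib
      by (subst sum.swap) (simp add: mult.assoc sum_distrib_left sum_divide_distrib)
    also have "\<dots> = (\<Sum>f\<in>t. if f = v then u v * slice_inner n k v v else 0)"
      using orth t v by (intro sum.cong) (auto simp: pairwise_def)
    also have "\<dots> = u v * slice_inner n k v v" using t v by simp
    finally show False using nz[of v] t v by auto
  qed
  moreover have "slice_functions n k \<subseteq> real_fun.span F"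
  proof (rule ccontr)
    assume "\<not> slice_functions n k \<subseteq> real_fun.span F"
    then obtain f where f: "f \<in> slice_functions n k" "f \<notin> real_fun.span F"
      by (meson subsetI)
    let ?D = "(\<lambda>x y. if y = x then 1 else 0 :: real) ` slice n k"
    have "real_fun.independent (insert f F)"
      using f(2) ind by (rule real_fun.independent_insertI)
    moreover have "insert f F \<subseteq> real_fun.span ?D"
      using f(1) subset_trans[OF sub slice_functions_subset_span]
        subsetD[OF slice_functions_subset_span f(1)] by simp
    ultimately have "card (insert f F) \<le> card ?D"
      by (rule real_fun.independent_span_bound[OF finite_imageI[OF finite_slice], THEN conjunct2])
    also have "\<dots> \<le> n choose k"
      unfolding card_slice[symmetric] by (rule card_image_le[OF finite_slice])
    finally have "card (insert f F) \<le> card F" unfolding card .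
    moreover have "f \<notin> F" using f(2) real_fun.span_base[of f F] by (rule contrapos_nn)
    ultimately show False using \<open>finite F\<close> by simp
  qed
  moreover have "real_fun.span F \<subseteq> slice_functions n k"
    using sub subspace_slice_functions by (rule real_fun.span_minimal)
  ultimately show ?thesis using orth by (auto simp: slice_orthogonal_basis_def)
qed

section \<open>Asymptotics of the norm\<close>

lemma falling_Suc: "falling m (Suc d) = falling m d * (real m - real d)"
  by (simp add: falling_def)

lemma falling_pos: "d \<le> m \<Longrightarrow> falling m d > 0"
  by (simp add: falling_eq_fact)

text \<open>Weierstrass' product inequality for the factors \<open>1 - i / m\<close>, whose deficits
  sum to at most \<open>d ^ 2 / (2 * m)\<close>.\<close>

lemma falling_ge:
  assumes "d \<le> m" "0 < m"
  shows "(1 - real d ^ 2 / (2 * real m)) * real m ^ d \<le> falling m d"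
proof -
  have "1 - real d ^ 2 / (2 * real m) \<le> 1 - (\<Sum>i<d. real i / real m)"
  proof -
    have "2 * (\<Sum>i<d. real i) \<le> real d ^ 2"
      by (induction d) (auto simp: power2_eq_square algebra_simps)
    then show ?thesis
      using assms by (simp add: sum_divide_distrib[symmetric] field_simps)
  qed
  also have "\<dots> \<le> (\<Prod>i<d. 1 - real i / real m)"
    using assms by (intro Weierstrass_prod_ineq) auto
  also have "\<dots> = falling m d / real m ^ d"
  proof -
    have "(\<Prod>i<d. 1 - real i / real m) = (\<Prod>i<d. (real m - real i) / real m)"
      using assms by (intro prod.cong) (auto simp: field_simps)
    then show ?thesis by (simp add: falling_def prod_dividef)
  qed
  finally show ?thesis using assms by (simp add: field_simps)
qed

lemma falling_le_power: "d \<le> m \<Longrightarrow> falling m d \<le> real m ^ d"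
proof -
  assume "d \<le> m"
  then have "(\<Prod>i<d. real m - real i) \<le> (\<Prod>i<d. real m)" by (intro prod_mono) auto
  then show ?thesis by (simp add: falling_def)
qed

text \<open>Since \<open>(k - i) (n - k - i) / (k (n - k)) \<le> (n - 2 i)\<^sup>2 / n\<^sup>2\<close>, the ratio is at most a product
  of factors \<open>(n - 2 i) / (n - 2 i - 1)\<close>, which telescopes after enlarging the numerators by 1.\<close>

lemma falling_ratio_le_telescoped:
  assumes "2 * k \<le> n" "d \<le> k"
  shows "falling k d * falling (n - k) d * (real n) ^ (2 * d) * (real n - 2 * real d + 1)
    \<le> (real n + 1) * falling n (2 * d) * (real k * real (n - k)) ^ d"
  using assms(2)
proof (induction d)
  case (Suc d)
  define N where "N = real n"
  define l where "l = real (n - k)"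
  let ?N = N and ?k = "real k" and ?l = l and ?d = "real d"
  have n: "N = ?k + l" using assms(1) by (simp add: N_def l_def)
  have kd: "?d + 1 \<le> ?k" "?k \<le> ?l" using Suc.prems assms(1) by (auto simp: l_def)
  have key: "(?k - ?d) * (?l - ?d) * ?N\<^sup>2 \<le> (?N - 2 * ?d)\<^sup>2 * (?k * ?l)"
  proof -
    have "(?N - 2 * ?d)\<^sup>2 * (?k * ?l) - (?k - ?d) * (?l - ?d) * ?N\<^sup>2 =
        ?d * (?N - ?d) * (?k - ?l)\<^sup>2"
      unfolding n by algebra
    moreover have "?d * (?N - ?d) * (?k - ?l)\<^sup>2 \<ge> 0"
      using kd n by (intro mult_nonneg_nonneg) auto
    ultimately show ?thesis by linarith
  qed
  let ?X = "falling k d * falling (n - k) d * ?N ^ (2 * d)"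
  let ?Y = "(?N + 1) * falling n (2 * d) * (?k * ?l) ^ d"
  have IH: "?X * (?N - 2 * ?d + 1) \<le> ?Y" using Suc unfolding N_def l_def by simp
  have X: "?X \<ge> 0"
  proof -
    have "falling k d > 0" "falling (n - k) d > 0" "N \<ge> 0"
      using Suc.prems assms(1) by (auto simp: N_def intro!: falling_pos)
    then show ?thesis by simp
  qed
  have "?X * ((?k - ?d) * (?l - ?d) * ?N\<^sup>2) * (?N - 2 * ?d - 1)
      \<le> ?X * ((?N - 2 * ?d)\<^sup>2 * (?k * ?l)) * (?N - 2 * ?d - 1)"
    using kd n by (intro mult_right_mono[OF mult_left_mono[OF key X]]) linarith
  also have "\<dots> = (?X * (?N - 2 * ?d)) * ((?N - 2 * ?d) * (?k * ?l) * (?N - 2 * ?d - 1))"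
    by (simp add: power2_eq_square)
  also have "\<dots> \<le> ?Y * ((?N - 2 * ?d) * (?k * ?l) * (?N - 2 * ?d - 1))"
  proof (rule mult_right_mono)
    \<comment> \<open>This is the enlargement by 1, which produces the factor carried by the
      induction hypothesis.\<close>
    have "?X * (?N - 2 * ?d) \<le> ?X * (?N - 2 * ?d + 1)"
      by (rule mult_left_mono[OF _ X]) simp
    with IH show "?X * (?N - 2 * ?d) \<le> ?Y" by linarith
    show "0 \<le> (?N - 2 * ?d) * (?k * ?l) * (?N - 2 * ?d - 1)" using kd n by simp
  qed
  finally have "?X * ((?k - ?d) * (?l - ?d) * ?N\<^sup>2) * (?N - 2 * ?d - 1)
      \<le> ?Y * ((?N - 2 * ?d) * (?k * ?l) * (?N - 2 * ?d - 1))" .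
  moreover have "falling k (Suc d) * falling (n - k) (Suc d) * N ^ (2 * Suc d) *
      (N - 2 * real (Suc d) + 1) = ?X * ((?k - ?d) * (?l - ?d) * ?N\<^sup>2) * (?N - 2 * ?d - 1)"
  proof -
    have "N ^ (2 * Suc d) = N ^ (2 * d) * N\<^sup>2" "N - 2 * real (Suc d) + 1 = N - 2 * ?d - 1"
      by (simp_all add: power2_eq_square)
    then show ?thesis unfolding falling_Suc l_def[symmetric] by (simp only: mult_ac)
  qed
  moreover have "(N + 1) * falling n (2 * Suc d) * (?k * l) ^ Suc d =
      ?Y * ((?N - 2 * ?d) * (?k * ?l) * (?N - 2 * ?d - 1))"
    by (simp add: falling_Suc N_def[symmetric] diff_diff_eq)
  ultimately show ?case unfolding N_def l_def by metis
qed (simp add: falling_def)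

text \<open>The telescoped bound leaves the error factor \<open>(n + 1) / (n - 2 * d + 1)\<close>,
  to be compared with \<open>1 + 8 * d ^ 2 / n\<close>.\<close>

lemma falling_ratio_upper:
  assumes "2 * k \<le> n" "d \<le> k" "1 \<le> n"
  shows "falling k d * falling (n - k) d / falling n (2 * d)
    \<le> (1 + 8 * real d ^ 2 / real n) * (real k / real n * (1 - real k / real n)) ^ d"
proof -
  let ?N = "real n" and ?Q = "(real k * real (n - k)) ^ d"
  have F: "falling n (2 * d) > 0" using falling_pos[of "2 * d" n] assms by simp
  have N: "?N > 0" "?N - 2 * real d + 1 > 0" using assms by auto
  have Q: "(real k / ?N * (1 - real k / ?N)) ^ d = ?Q / ?N ^ (2 * d)"
  proof -
    have "real k / ?N * (1 - real k / ?N) = real k * real (n - k) / ?N\<^sup>2"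
      using assms by (simp add: field_simps power2_eq_square)
    then show ?thesis by (simp add: power_divide power_mult)
  qed
  \<comment> \<open>The left side is \<open>1 + 2 * d / (n - 2 * d + 1)\<close>. If
    \<open>4 * d \<le> n\<close>, the denominator is at least \<open>n / 2\<close>; otherwise it is
    at least 1 and \<open>n < 4 * d\<close>, which is where 8 = 2 * 4 comes from.\<close>
  have b: "(?N + 1) / (?N - 2 * real d + 1) \<le> 1 + 8 * real d ^ 2 / ?N"
  proof (cases "d = 0")
    case False
    then have d: "real d \<ge> 1" by simp
    have "2 * real d * ?N \<le> 8 * real d ^ 2 * (?N - 2 * real d + 1)"
    proof (cases "4 * d \<le> n")
      case True
      then have "real (4 * d) \<le> ?N" by (simp only: of_nat_le_iff)
      then have "?N \<le> 2 * (?N - 2 * real d + 1)" by simp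
      then have "2 * real d * ?N \<le> 2 * real d * (2 * (?N - 2 * real d + 1))"
        by (intro mult_left_mono) auto
      also have "\<dots> = 4 * (real d * 1) * (?N - 2 * real d + 1)" by simp
      also have "\<dots> \<le> 8 * (real d * real d) * (?N - 2 * real d + 1)"
        using d N by (intro mult_right_mono mult_mono) auto
      finally show ?thesis by (simp add: power2_eq_square)
    next
      case False
      then have "2 * real d * ?N \<le> 2 * real d * (4 * real d)"
        by (intro mult_left_mono) auto
      also have "\<dots> = 8 * real d ^ 2 * 1" by (simp add: power2_eq_square)
      also have "\<dots> \<le> 8 * real d ^ 2 * (?N - 2 * real d + 1)"
        using assms by (intro mult_left_mono) auto
      finally show ?thesis .
    qed
    then show ?thesis using N by (simp add: field_simps)
  qed simp
  have cross: "A / F \<le> c / M * (Q / W)" if "A * W * M \<le> c * F * Q" "F > 0" "M > 0" "W > 0"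
    for A F c M Q W :: real
    using that by (simp add: field_simps)
  have "falling k d * falling (n - k) d / falling n (2 * d)
      \<le> (?N + 1) / (?N - 2 * real d + 1) * (?Q / ?N ^ (2 * d))"
    using falling_ratio_le_telescoped[OF assms(1,2)] F N by (intro cross) auto
  also have "\<dots> \<le> (1 + 8 * real d ^ 2 / ?N) * (?Q / ?N ^ (2 * d))"
    using b by (intro mult_right_mono) auto
  finally show ?thesis unfolding Q .
qed

text \<open>With \<open>e = d ^ 2 / (2 * k)\<close>, both numerators lose at most a factor
  \<open>1 - e\<close>, because \<open>k \<le> n - k\<close>; moreover
  \<open>(1 - e) ^ 2 \<ge> 1 - 2 * e\<close>, and the denominator is at most
  \<open>n ^ (2 * d)\<close>. Multiplying the bounds needs \<open>e \<le> 1\<close>; when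
  \<open>d ^ 2 > k\<close> the left side is nonpositive anyway.\<close>

lemma falling_ratio_lower:
  assumes "2 * k \<le> n" "d \<le> k" "1 \<le> k"
  shows "(1 - real d ^ 2 / real k) * (real k / real n * (1 - real k / real n)) ^ d
    \<le> falling k d * falling (n - k) d / falling n (2 * d)"
proof (cases "real d ^ 2 / real k \<le> 1")
  case True
  let ?e = "real d ^ 2 / (2 * real k)" and ?N = "real n"
  let ?Q = "(real k * real (n - k)) ^ d"
  have kl: "real k \<le> real (n - k)" "0 < n - k" "d \<le> n - k" using assms by auto
  have F: "falling n (2 * d) > 0" using falling_pos[of "2 * d" n] assms by simp
  have Q: "(real k / ?N * (1 - real k / ?N)) ^ d = ?Q / ?N ^ (2 * d)"
  proof -
    have "real k / ?N * (1 - real k / ?N) = real k * real (n - k) / ?N\<^sup>2"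
      using assms by (simp add: field_simps power2_eq_square)
    then show ?thesis by (simp add: power_divide power_mult)
  qed
  have e: "?e \<le> 1" using True by (simp add: field_simps)
  have "(1 - real d ^ 2 / real k) * ?Q \<le> (1 - ?e) * (1 - ?e) * ?Q"
  proof (rule mult_right_mono)
    have "(1 - ?e) * (1 - ?e) = 1 - real d ^ 2 / real k + ?e * ?e"
      using assms by (simp add: field_simps)
    then show "1 - real d ^ 2 / real k \<le> (1 - ?e) * (1 - ?e)" by simp
  qed simp
  also have "\<dots> = ((1 - ?e) * real k ^ d) * ((1 - ?e) * real (n - k) ^ d)"
    by (simp only: power_mult_distrib mult_ac)
  also have "\<dots> \<le> falling k d * falling (n - k) d"
  proof (rule mult_mono)
    show "(1 - ?e) * real k ^ d \<le> falling k d" using falling_ge[of d k] assms by simp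
    have "real d ^ 2 / (2 * real (n - k)) \<le> ?e"
      using kl assms by (intro divide_left_mono) auto
    then have "(1 - ?e) * real (n - k) ^ d \<le> (1 - real d ^ 2 / (2 * real (n - k))) * real (n - k) ^ d"
      by (intro mult_right_mono diff_left_mono zero_le_power of_nat_0_le_iff)
    also have "\<dots> \<le> falling (n - k) d" using kl by (intro falling_ge) auto
    finally show "(1 - ?e) * real (n - k) ^ d \<le> falling (n - k) d" .
    show "0 \<le> falling k d" using falling_pos[of d k] assms by simp
    show "0 \<le> (1 - ?e) * real (n - k) ^ d" using e by simp
  qed
  finally have *: "(1 - real d ^ 2 / real k) * ?Q \<le> falling k d * falling (n - k) d" .
  have "(1 - real d ^ 2 / real k) * (?Q / ?N ^ (2 * d))
      = (1 - real d ^ 2 / real k) * ?Q / ?N ^ (2 * d)" by simp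
  also have "\<dots> \<le> falling k d * falling (n - k) d / ?N ^ (2 * d)"
    using * by (rule divide_right_mono) simp
  also have "\<dots> \<le> falling k d * falling (n - k) d / falling n (2 * d)"
    using falling_pos[of d k] falling_pos[of d "n - k"] F kl assms
    by (intro divide_left_mono falling_le_power mult_nonneg_nonneg mult_pos_pos) auto
  finally show ?thesis unfolding Q .
next
  case False
  have "(1 - real d ^ 2 / real k) * (real k / real n * (1 - real k / real n)) ^ d \<le> 0"
    using False assms
    by (intro mult_nonpos_nonneg zero_le_power mult_nonneg_nonneg) (auto simp: field_simps)
  also have "\<dots> \<le> falling k d * falling (n - k) d / falling n (2 * d)"
    using assms by (intro divide_nonneg_nonneg mult_nonneg_nonneg less_imp_le[OF falling_pos]) auto
  finally show ?thesis .
qed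

section \<open>Assembly of the basis and the norm estimates\<close>

text \<open>\<open>C\<close> is chosen ahead of \<open>n\<close> and \<open>k\<close>, so the
  constant depends on \<open>p\<close> alone. Injectivity is a separate conjunct because the basis
  property concerns the image set, which would not reveal two top sets with the same
  function.\<close>

theorem theorem4p1:
  shows "\<exists>C :: real \<Rightarrow> real. \<forall>n k :: nat. \<forall>p :: real.
    1 \<le> n \<and> 2 * k \<le> n \<and> p = real k / real n \<longrightarrow>
      inj_on (\<lambda>B. slice_restrict n k (chi n B)) (\<Union>d\<le>k. top_sets n d) \<and>
      slice_orthogonal_basis n k ((\<lambda>B. slice_restrict n k (chi n B)) ` (\<Union>d\<le>k. top_sets n d)) \<and>
      (\<forall>d\<le>k. \<forall>B \<in> top_sets n d.
        (slice_norm n k (slice_restrict n k (chi n B)))\<^sup>2 =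
          c_top B * 2 ^ d * (falling k d * falling (n - k) d / falling n (2 * d)) \<and>
        (1 - C p * real (d\<^sup>2) / real n) * (c_top B * (2 * p * (1 - p)) ^ d)
          \<le> (slice_norm n k (slice_restrict n k (chi n B)))\<^sup>2 \<and>
        (slice_norm n k (slice_restrict n k (chi n B)))\<^sup>2
          \<le> (1 + C p * real (d\<^sup>2) / real n) * (c_top B * (2 * p * (1 - p)) ^ d))"
\<comment> \<open>The 8 serves the upper bound. The \<open>1 / p\<close> serves the lower one, whose
  error \<open>d ^ 2 / k\<close> equals \<open>(1 / p) * d ^ 2 / n\<close>.\<close>
proof (intro exI[of _ "\<lambda>p. 8 + 1 / p"] allI impI, elim conjE)
  fix n k :: nat and p :: real
  assume n: "1 \<le> n" and k: "2 * k \<le> n" and p: "p = real k / real n"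
  let ?I = "\<Union>d\<le>k. top_sets n d" and ?f = "\<lambda>B. slice_restrict n k (chi n B)"
  let ?R = "\<lambda>d. falling k d * falling (n - k) d / falling n (2 * d)"
  have inner: "slice_inner n k (?f B) (?f B') =
      (if B = B' then c_top B * 2 ^ length B * ?R (length B) else 0)"
    if "B \<in> ?I" "B' \<in> ?I" for B B'
    using that slice_inner_chi[OF k, of B B'] unfolding Union_top_sets by auto
  have R: "?R d > 0" if "d \<le> k" for d
    using that k falling_pos[of d k] falling_pos[of d "n - k"] falling_pos[of "2 * d" n] by simp
  have pos: "slice_inner n k (?f B) (?f B) > 0" if "B \<in> ?I" for B
  proof -
    have "ballot B" "length B \<le> k" using that unfolding Union_top_sets by auto
    then have "0 < c_top B * 2 ^ length B" "0 < ?R (length B)"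
      using R c_top_pos by simp_all
    then show ?thesis using mult_pos_pos inner[OF that that] by metis
  qed
  have inj: "inj_on ?f ?I"
  proof (rule inj_onI, rule ccontr)
    fix B B' assume B: "B \<in> ?I" "B' \<in> ?I" "?f B = ?f B'" "B \<noteq> B'"
    \<comment> \<open>The common function would have a positive inner product with itself, yet
      orthogonality makes it 0.\<close>
    then show False using pos[OF B(1)] inner[OF B(1,2)] by simp
  qed
  have basis: "slice_orthogonal_basis n k (?f ` ?I)"
  proof (rule slice_orthogonal_basisI)
    show "?f ` ?I \<subseteq> slice_functions n k"
      by (auto simp: slice_functions_def slice_restrict_def)
    show "finite (?f ` ?I)" unfolding Union_top_sets by (intro finite_imageI finite_ballots)
    show "pairwise (\<lambda>f g. slice_inner n k f g = 0) (?f ` ?I)"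
    proof (rule pairwiseI)
      fix f g assume "f \<in> ?f ` ?I" "g \<in> ?f ` ?I" "f \<noteq> g"
      then obtain B B' where "B \<in> ?I" "B' \<in> ?I" "f = ?f B" "g = ?f B'" "B \<noteq> B'" by blast
      then show "slice_inner n k f g = 0" using inner[of B B'] by simp
    qed
    show "slice_inner n k f f \<noteq> 0" if "f \<in> ?f ` ?I" for f
      using that pos by fastforce
    show "card (?f ` ?I) = n choose k"
      using card_image[OF inj] card_ballots[of k n] k unfolding Union_top_sets by simp
  qed (use k in simp)
  have norm: "(slice_norm n k (?f B))\<^sup>2 = c_top B * 2 ^ d * ?R d \<and>
      (1 - (8 + 1 / p) * real (d\<^sup>2) / real n) * (c_top B * (2 * p * (1 - p)) ^ d)
        \<le> (slice_norm n k (?f B))\<^sup>2 \<and>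
      (slice_norm n k (?f B))\<^sup>2
        \<le> (1 + (8 + 1 / p) * real (d\<^sup>2) / real n) * (c_top B * (2 * p * (1 - p)) ^ d)"
    if d: "d \<le> k" and B: "B \<in> top_sets n d" for d B
  proof -
    let ?w = "c_top B * 2 ^ d" and ?q = "(p * (1 - p)) ^ d"
    have BI: "B \<in> ?I" "length B = d" "ballot B" using d B by (auto simp: top_sets_iff_ballot)
    have norm: "(slice_norm n k (?f B))\<^sup>2 = ?w * ?R d"
      using pos[OF BI(1)] inner[OF BI(1) BI(1)] BI(2) by (simp add: slice_norm_def)
    have w: "?w \<ge> 0" using c_top_pos[OF BI(3)] by simp
    have p01: "0 \<le> p" "p \<le> 1" using p k n by auto
    have q: "?q \<ge> 0" using p01 by simp
    have main: "c_top B * (2 * p * (1 - p)) ^ d = ?w * ?q"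
      by (simp add: power_mult_distrib mult.assoc)
    have "(1 - (8 + 1 / p) * real (d\<^sup>2) / real n) * ?q \<le> ?R d"
    proof (cases "k = 0")
      \<comment> \<open>Here \<open>d = 0\<close>, and the convention \<open>1 / 0 = 0\<close> keeps
        the constant defined at \<open>p = 0\<close>.\<close>
      case True
      then show ?thesis using d by (simp add: falling_def)
    next
      case False
      have "real d ^ 2 / real k = 1 / p * real (d\<^sup>2) / real n" using p n by simp
      also have "\<dots> \<le> (8 + 1 / p) * real (d\<^sup>2) / real n"
        by (intro divide_right_mono mult_right_mono) auto
      finally have "(1 - (8 + 1 / p) * real (d\<^sup>2) / real n) * ?q \<le> (1 - real d ^ 2 / real k) * ?q"
        using q by (intro mult_right_mono) auto
      also have "\<dots> \<le> ?R d" unfolding p using False k d by (intro falling_ratio_lower) auto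
      finally show ?thesis .
    qed
    then have lower: "?w * ((1 - (8 + 1 / p) * real (d\<^sup>2) / real n) * ?q) \<le> ?w * ?R d"
      using w by (rule mult_left_mono)
    have "?R d \<le> (1 + 8 * real d ^ 2 / real n) * ?q"
      unfolding p using k d n by (rule falling_ratio_upper)
    also have "\<dots> \<le> (1 + (8 + 1 / p) * real (d\<^sup>2) / real n) * ?q"
    proof -
      have "8 * real d ^ 2 \<le> (8 + 1 / p) * real (d\<^sup>2)"
        using p01 by (simp add: algebra_simps)
      then show ?thesis using q by (intro mult_right_mono add_left_mono divide_right_mono) auto
    qed
    finally have upper: "?w * ?R d \<le> ?w * ((1 + (8 + 1 / p) * real (d\<^sup>2) / real n) * ?q)"
      using w by (rule mult_left_mono)
    show ?thesis using lower upper unfolding norm main by (simp only: mult.left_commute)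
  qed
  show "inj_on ?f ?I \<and> slice_orthogonal_basis n k (?f ` ?I) \<and>
    (\<forall>d\<le>k. \<forall>B\<in>top_sets n d. (slice_norm n k (?f B))\<^sup>2 = c_top B * 2 ^ d * ?R d \<and>
      (1 - (8 + 1 / p) * real (d\<^sup>2) / real n) * (c_top B * (2 * p * (1 - p)) ^ d)
        \<le> (slice_norm n k (?f B))\<^sup>2 \<and>
      (slice_norm n k (?f B))\<^sup>2
        \<le> (1 + (8 + 1 / p) * real (d\<^sup>2) / real n) * (c_top B * (2 * p * (1 - p)) ^ d))"
    using inj basis norm by blast
qed

end
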